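(* Consider a combinatorial problem with ground set $\mathcal{U}$ ($|\mathcal U|=n$) and feasible family $\mathcal{F}$. If the exact version of the problem admits a pseudopolynomial-time algorithm, then the top-$\ell$ maximization problem $\max_{S\in\mathcal{F}}\mathrm{top}_\ell(\boldsymbol{v}[S])$ can be solved in polynomial time whenever all values $v_e$ are nonnegative integers bounded by a polynomial in $n$.
   Context: Exact version: given nonnegative integer values $v_e$ and an integer $K$, find $S\in\mathcal{F}$ with $\sum_{e\in S}v_e=K$ or report that none exists; pseudopolynomial time means time polynomial in $n$ and $K$. $\mathrm{top}_\ell(x)$ is the sum of the $\ell$ largest entries (in absolute value); $\boldsymbol{v}[S]$ has entries $v_e\mathbf{1}[e\in S]$. *)

theory Defs
  imports "HOL-Computational_Algebra.Polynomial"
begin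

section \<open>Machine model\<close>

text \<open>
  Algorithms are WHILE programs in the style of Jones over a pointer structure whose leaves hold
  natural numbers.  Every command costs one unit.  Values are immutable, so copying a value or
  building a pair is a pointer operation, and since numbers are only combined by addition and
  truncated subtraction (no multiplication), their bit length grows by at most one per operator
  evaluated.  Hence, as for the RAM with addition and subtraction, a Turing machine simulates a
  run in time polynomial in the number of steps and the size of the input.  Expressions
  may be nested, but a program contains only finitely many of them, so charging a single unit for
  each evaluation only affects constant factors.
\<close>

datatype val = Num nat | Pair val val

fun num_of :: "val \<Rightarrow> nat" where
  "num_of (Num k) = k"
| "num_of (Pair a b) = 0"

fun fst_of :: "val \<Rightarrow> val" where
  "fst_of (Num k) = Num 0"
| "fst_of (Pair a b) = a"

fun snd_of :: "val \<Rightarrow> val" where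
  "snd_of (Num k) = Num 0"
| "snd_of (Pair a b) = b"

fun is_pair :: "val \<Rightarrow> bool" where
  "is_pair (Num k) = False"
| "is_pair (Pair a b) = True"

datatype expr =
    Lit nat
  | Var nat
  | MkPair expr expr
  | Fst expr
  | Snd expr
  | IsPair expr
  | Add expr expr
  | Sub expr expr

type_synonym state = "nat \<Rightarrow> val"

fun eval_expr :: "expr \<Rightarrow> state \<Rightarrow> val" where
  "eval_expr (Lit k) s = Num k"
| "eval_expr (Var i) s = s i"
| "eval_expr (MkPair a b) s = Pair (eval_expr a s) (eval_expr b s)"
| "eval_expr (Fst a) s = fst_of (eval_expr a s)"
| "eval_expr (Snd a) s = snd_of (eval_expr a s)"
| "eval_expr (IsPair a) s = Num (of_bool (is_pair (eval_expr a s)))"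
| "eval_expr (Add a b) s = Num (num_of (eval_expr a s) + num_of (eval_expr b s))"
| "eval_expr (Sub a b) s = Num (num_of (eval_expr a s) - num_of (eval_expr b s))"

datatype com =
    Skip
  | Assign nat expr
  | Seq com com
  | Cond expr com com
  | While expr com

text \<open>\<open>exec c s t s'\<close>: started in \<open>s\<close>, the program \<open>c\<close> halts in \<open>s'\<close> after exactly \<open>t\<close> steps.
  A test succeeds iff its value differs from \<open>Num 0\<close>.\<close>

inductive exec :: "com \<Rightarrow> state \<Rightarrow> nat \<Rightarrow> state \<Rightarrow> bool" where
  exec_Skip: "exec Skip s 1 s"
| exec_Assign: "exec (Assign i a) s 1 (s(i := eval_expr a s))"
| exec_Seq: "exec c s t s' \<Longrightarrow> exec d s' u s'' \<Longrightarrow> exec (Seq c d) s (t + u) s''"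
| exec_CondT: "eval_expr a s \<noteq> Num 0 \<Longrightarrow> exec c s t s' \<Longrightarrow> exec (Cond a c d) s (1 + t) s'"
| exec_CondF: "eval_expr a s = Num 0 \<Longrightarrow> exec d s t s' \<Longrightarrow> exec (Cond a c d) s (1 + t) s'"
| exec_WhileF: "eval_expr a s = Num 0 \<Longrightarrow> exec (While a c) s 1 s"
| exec_WhileT: "eval_expr a s \<noteq> Num 0 \<Longrightarrow> exec c s t s' \<Longrightarrow> exec (While a c) s' u s'' \<Longrightarrow>
    exec (While a c) s (1 + t + u) s''"

text \<open>Variable \<open>0\<close> holds the input at the start and the output at the end; all other variables
  are initially \<open>Num 0\<close>.\<close>

definition init_state :: "val \<Rightarrow> state" where
  "init_state x = (\<lambda>_. Num 0)(0 := x)"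

definition outputs_within :: "com \<Rightarrow> val \<Rightarrow> nat \<Rightarrow> val \<Rightarrow> bool" where
  "outputs_within c x T y \<longleftrightarrow> (\<exists>t s'. exec c (init_state x) t s' \<and> t \<le> T \<and> s' 0 = y)"

section \<open>Combinatorial problems\<close>

text \<open>
  A problem is a class of instances; each instance is given to an algorithm by a description
  \<open>x :: val\<close> (for example an encoded graph) and determines a ground set, identified with
  \<open>{..<n}\<close> for \<open>n = ground_size P x\<close>, and a family of feasible subsets of it.  How \<open>x\<close> determines
  the family is arbitrary.
\<close>

record comb_problem =
  instances :: "val set"
  ground_size :: "val \<Rightarrow> nat"
  feasible :: "val \<Rightarrow> nat set set"

definition comb_problem :: "comb_problem \<Rightarrow> bool" where
  "comb_problem P \<longleftrightarrow> (\<forall>x\<in>instances P. feasible P x \<subseteq> Pow {..<ground_size P x})"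

fun enc_list :: "nat list \<Rightarrow> val" where
  "enc_list [] = Num 0"
| "enc_list (k # ks) = Pair (Num k) (enc_list ks)"

text \<open>An input consists of the instance description, the list of the values of the elements of
  the ground set, and one further number (the target of the exact version, respectively \<open>l\<close>).\<close>

definition enc_input :: "val \<Rightarrow> nat \<Rightarrow> (nat \<Rightarrow> nat) \<Rightarrow> nat \<Rightarrow> val" where
  "enc_input x n v k = Pair x (Pair (enc_list (map v [0..<n])) (Num k))"

text \<open>An answer is either the report that there is no solution or the characteristic vector of a
  subset of the ground set.\<close>

fun enc_answer :: "nat \<Rightarrow> nat set option \<Rightarrow> val" where
  "enc_answer n None = Num 0"
| "enc_answer n (Some S) = Pair (Num 1) (enc_list (map (\<lambda>e. of_bool (e \<in> S)) [0..<n]))"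

section \<open>The exact version and top-\<open>l\<close> maximization\<close>

definition exact_answer :: "nat set set \<Rightarrow> (nat \<Rightarrow> nat) \<Rightarrow> nat \<Rightarrow> nat set option \<Rightarrow> bool" where
  "exact_answer F v K r \<longleftrightarrow>
    (case r of
      None \<Rightarrow> \<not> (\<exists>S\<in>F. (\<Sum>e\<in>S. v e) = K)
    | Some S \<Rightarrow> S \<in> F \<and> (\<Sum>e\<in>S. v e) = K)"

text \<open>Sum of the \<open>l\<close> largest entries in absolute value (of all entries, if there are fewer).\<close>

definition top_sum :: "nat \<Rightarrow> 'a::linordered_idom list \<Rightarrow> 'a" where
  "top_sum l xs = sum_list (take l (rev (sort (map abs xs))))"

definition masked :: "nat \<Rightarrow> (nat \<Rightarrow> nat) \<Rightarrow> nat set \<Rightarrow> int list" where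
  "masked n v S = map (\<lambda>e. int (v e) * of_bool (e \<in> S)) [0..<n]"

definition top_max_answer ::
  "nat \<Rightarrow> nat set set \<Rightarrow> (nat \<Rightarrow> nat) \<Rightarrow> nat \<Rightarrow> nat set option \<Rightarrow> bool" where
  "top_max_answer n F v l r \<longleftrightarrow>
    (case r of
      None \<Rightarrow> F = {}
    | Some S \<Rightarrow> is_arg_max (\<lambda>S. top_sum l (masked n v S)) (\<lambda>S. S \<in> F) S)"

text \<open>A bound that is polynomial in \<open>n\<close> and \<open>K\<close> jointly amounts to a polynomial bound
  in \<open>n + K\<close>; real coefficients can be replaced by natural numbers that dominate them.\<close>

definition exact_pseudopoly_solvable :: "comb_problem \<Rightarrow> bool" where
  "exact_pseudopoly_solvable P \<longleftrightarrow>
    (\<exists>c (p :: nat poly). \<forall>x\<in>instances P. \<forall>v K. \<exists>r.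
      outputs_within c (enc_input x (ground_size P x) v K)
        (poly p (ground_size P x + K)) (enc_answer (ground_size P x) r) \<and>
      exact_answer (feasible P x) v K r)"

definition top_max_poly_solvable :: "comb_problem \<Rightarrow> nat poly \<Rightarrow> bool" where
  "top_max_poly_solvable P q \<longleftrightarrow>
    (\<exists>c (p :: nat poly). \<forall>x\<in>instances P. \<forall>v l.
      (\<forall>e<ground_size P x. v e \<le> poly q (ground_size P x)) \<longrightarrow>
      (\<exists>r. outputs_within c (enc_input x (ground_size P x) v l)
             (poly p (ground_size P x)) (enc_answer (ground_size P x) r) \<and>
           top_max_answer (ground_size P x) (feasible P x) v l r))"

end

(*
  For a threshold r and a tie-breaking position j let T be the set of elements whose value exceeds r,
  or equals r at a position before j.  If S meets T in at most l elements, then the value of S \<inter> T is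
  a lower bound for the top-l sum of S, and equality holds for a suitable pair (r, j).  With M larger
  than the sum of all values, the weights w_e = [e \<in> T] (M + v_e) give S the total k M + m, where k is
  the number and m the value of the elements of S \<inter> T.  So it suffices to ask the exact solver for
  every r < M, j \<le> n, k \<le> min n l and m < M, and to keep the answer with the largest m.
*)

theory Submission
  imports Defs
begin

section \<open>Top sums and thresholds\<close>

text \<open>Each entry satisfies \<open>y \<le> r + max 0 (y - r)\<close>.\<close>

lemma sum_list_le_threshold:
  fixes ys :: "int list"
  assumes "0 \<le> r"
  shows "sum_list ys \<le> int (length ys) * r + (\<Sum>y\<leftarrow>ys. max 0 (y - r))"
  by (induction ys) (auto simp: algebra_simps max_def)

lemma sum_list_sorted_abs:
  "(\<Sum>y\<leftarrow>rev (sort (map abs xs)). f y) = (\<Sum>x\<leftarrow>xs. f \<bar>x\<bar>)"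
  for xs :: "int list" and f :: "int \<Rightarrow> int"
proof -
  have "mset (map f (rev (sort (map abs xs)))) = mset (map (\<lambda>x. f \<bar>x\<bar>) xs)"
    by (simp add: multiset.map_comp comp_def)
  then show ?thesis by (metis sum_mset_sum_list)
qed

text \<open>One half of the dual formula for top sums, the minimum over \<open>r \<ge> 0\<close> of
  \<open>l * r\<close> plus the total excess over \<open>r\<close>. At most \<open>l\<close> entries
  are chosen, and extending the excess from them to the whole list adds only nonnegative
  terms.\<close>

lemma top_sum_le_threshold:
  fixes xs :: "int list"
  assumes "0 \<le> r"
  shows "top_sum l xs \<le> int l * r + (\<Sum>x\<leftarrow>xs. max 0 (\<bar>x\<bar> - r))"
proof -
  define ys where "ys = rev (sort (map abs xs))"
  have "sum_list (take l ys) \<le> int (length (take l ys)) * r + (\<Sum>y\<leftarrow>take l ys. max 0 (y - r))"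
    by (rule sum_list_le_threshold[OF assms])
  also have "\<dots> \<le> int l * r + (\<Sum>y\<leftarrow>ys. max 0 (y - r))"
  proof (rule add_mono)
    show "int (length (take l ys)) * r \<le> int l * r"
      using assms by (intro mult_right_mono) auto
    have "(\<Sum>y\<leftarrow>ys. max 0 (y - r)) =
        (\<Sum>y\<leftarrow>take l ys. max 0 (y - r)) + (\<Sum>y\<leftarrow>drop l ys. max 0 (y - r))"
      by (metis append_take_drop_id map_append sum_list_append)
    moreover have "0 \<le> (\<Sum>y\<leftarrow>drop l ys. max 0 (y - r))"
      by (rule sum_list_nonneg) auto
    ultimately show "(\<Sum>y\<leftarrow>take l ys. max 0 (y - r)) \<le> (\<Sum>y\<leftarrow>ys. max 0 (y - r))"
      by simp
  qed
  also have "(\<Sum>y\<leftarrow>ys. max 0 (y - r)) = (\<Sum>x\<leftarrow>xs. max 0 (\<bar>x\<bar> - r))"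
    unfolding ys_def by (rule sum_list_sorted_abs)
  finally show ?thesis by (simp add: top_sum_def ys_def)
qed

text \<open>The other half: the minimum is attained. At a threshold separating the \<open>l\<close>
  largest entries from the rest, the former lose nothing by truncation and the latter have no
  excess.\<close>

lemma top_sum_eq_threshold:
  fixes xs :: "int list"
  shows "\<exists>r\<ge>0. top_sum l xs = int l * r + (\<Sum>x\<leftarrow>xs. max 0 (\<bar>x\<bar> - r))"
proof -
  define ys where "ys = rev (sort (map abs xs))"
  \<comment> \<open>Indexing from 0, \<open>ys ! l\<close> is the largest entry not chosen. If all
    entries are chosen, 0 lies below them.\<close>
  define r where "r = (if l < length ys then ys ! l else 0)"
  have nonneg: "0 \<le> y" if "y \<in> set ys" for y
    using that by (auto simp: ys_def)
  have desc: "ys ! j \<le> ys ! i" if "i \<le> j" "j < length ys" for i j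
    using that unfolding ys_def
    by (metis length_rev rev_rev_ident sorted_rev_nth_mono sorted_sort)
  have r: "0 \<le> r"
    unfolding r_def using nonneg by auto
  have "r \<le> y" if "y \<in> set (take l ys)" for y
  proof -
    obtain i where "i < l" "i < length ys" "y = ys ! i"
      using \<open>y \<in> set (take l ys)\<close> by (auto simp: in_set_conv_nth)
    then show ?thesis unfolding r_def using desc[of i l] nonneg by auto
  qed
  then have "(\<Sum>y\<leftarrow>take l ys. max 0 (y - r)) = (\<Sum>y\<leftarrow>take l ys. y - r)"
    by (intro arg_cong[where f = sum_list] map_cong) auto
  moreover have "(\<Sum>y\<leftarrow>take l ys. y - r) = sum_list (take l ys) - int (length (take l ys)) * r"
    by (simp add: sum_list_subtractf sum_list_triv)
  \<comment> \<open>Either exactly \<open>l\<close> entries are taken, or the list is too short and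
    \<open>r = 0\<close>.\<close>
  moreover have "int (length (take l ys)) * r = int l * r"
    by (auto simp: r_def)
  moreover have "(\<Sum>y\<leftarrow>drop l ys. max 0 (y - r)) = 0"
  proof -
    have "y \<le> r" if "y \<in> set (drop l ys)" for y
    proof -
      obtain i where "i < length ys - l" "y = ys ! (l + i)"
        using \<open>y \<in> set (drop l ys)\<close> by (auto simp: in_set_conv_nth)
      then show ?thesis unfolding r_def using desc[of l "l + i"] by auto
    qed
    then have "(\<Sum>y\<leftarrow>drop l ys. max 0 (y - r)) = (\<Sum>y\<leftarrow>drop l ys. 0)"
      by (intro arg_cong[where f = sum_list] map_cong) auto
    then show ?thesis by simp
  qed
  moreover have "(\<Sum>y\<leftarrow>ys. max 0 (y - r)) =
      (\<Sum>y\<leftarrow>take l ys. max 0 (y - r)) + (\<Sum>y\<leftarrow>drop l ys. max 0 (y - r))"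
    by (metis append_take_drop_id map_append sum_list_append)
  moreover have "(\<Sum>y\<leftarrow>ys. max 0 (y - r)) = (\<Sum>x\<leftarrow>xs. max 0 (\<bar>x\<bar> - r))"
    unfolding ys_def by (rule sum_list_sorted_abs)
  moreover have "top_sum l xs = sum_list (take l ys)"
    by (simp add: top_sum_def ys_def)
  ultimately have "top_sum l xs = int l * r + (\<Sum>x\<leftarrow>xs. max 0 (\<bar>x\<bar> - r))"
    by linarith
  with r show ?thesis by blast
qed

section \<open>Top sums of a feasible set and threshold sets with tie-breaking\<close>

lemma masked_excess:
  assumes "S \<subseteq> {..<n}" "0 \<le> r"
  shows "(\<Sum>x\<leftarrow>masked n v S. max 0 (\<bar>x\<bar> - r)) = (\<Sum>e\<in>S. max 0 (int (v e) - r))"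
proof -
  have "(\<Sum>x\<leftarrow>masked n v S. max 0 (\<bar>x\<bar> - r)) =
      (\<Sum>e<n. max 0 (\<bar>int (v e) * of_bool (e \<in> S)\<bar> - r))"
    by (simp add: masked_def comp_def sum_list_distinct_conv_sum_set atLeast0LessThan
        flip: sum_set_upt_conv_sum_list_nat)
  also have "\<dots> = (\<Sum>e\<in>S. max 0 (\<bar>int (v e) * of_bool (e \<in> S)\<bar> - r))"
    using assms by (intro sum.mono_neutral_right) auto
  also have "\<dots> = (\<Sum>e\<in>S. max 0 (int (v e) - r))"
    by (intro sum.cong) auto
  finally show ?thesis .
qed

text \<open>The attained threshold avoids any comparison of \<open>A\<close> with the sorted list:
  each value is at most \<open>r\<close> plus its excess, the first parts add up to at most
  \<open>l * r\<close>, and the excesses over \<open>A\<close> are among those over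
  \<open>S\<close>.\<close>

lemma sum_le_top_sum:
  assumes "S \<subseteq> {..<n}" "A \<subseteq> S" "card A \<le> l"
  shows "int (\<Sum>e\<in>A. v e) \<le> top_sum l (masked n v S)"
proof -
  obtain r where r: "0 \<le> r"
    and top: "top_sum l (masked n v S) = int l * r + (\<Sum>e\<in>S. max 0 (int (v e) - r))"
    using top_sum_eq_threshold[of l "masked n v S"] masked_excess[OF assms(1)] by metis
  have "finite S" using assms(1) finite_subset by blast
  have "int (\<Sum>e\<in>A. v e) \<le> (\<Sum>e\<in>A. r + max 0 (int (v e) - r))"
    unfolding of_nat_sum by (rule sum_mono) auto
  also have "\<dots> = int (card A) * r + (\<Sum>e\<in>A. max 0 (int (v e) - r))"
    by (simp add: sum.distrib)
  also have "\<dots> \<le> int l * r + (\<Sum>e\<in>S. max 0 (int (v e) - r))"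
    using r assms \<open>finite S\<close> by (intro add_mono mult_right_mono sum_mono2) auto
  finally show ?thesis using top by simp
qed

text \<open>The position \<open>j\<close> breaks ties among the elements of value \<open>r\<close>.\<close>

definition tie_above :: "(nat \<Rightarrow> nat) \<Rightarrow> nat \<Rightarrow> nat \<Rightarrow> nat set" where
  "tie_above v r j = {e. r < v e + of_bool (e < j)}"

lemma top_sum_le_above:
  assumes S: "S \<subseteq> {..<n}"
  shows "\<exists>r \<le> (\<Sum>e<n. v e). \<exists>j\<le>n. card (S \<inter> tie_above v r j) \<le> l \<and>
    top_sum l (masked n v S) \<le> int (\<Sum>e\<in>S \<inter> tie_above v r j. v e)"
proof -
  have fin: "finite S" using S finite_subset by blast
  define V where "V = (\<Sum>e<n. v e)"
  have le_V: "v e \<le> V" if "e \<in> S" for e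
    unfolding V_def using that S by (intro member_le_sum) auto
  define r where "r = (LEAST r. card (S \<inter> tie_above v r 0) \<le> l)"
  \<comment> \<open>No single value exceeds the sum of all, so the least threshold exists and is at
    most \<open>V\<close>.\<close>
  have "S \<inter> tie_above v V 0 = {}"
    using le_V by (fastforce simp: tie_above_def)
  then have V: "card (S \<inter> tie_above v V 0) \<le> l" by simp
  have r: "card (S \<inter> tie_above v r 0) \<le> l"
    unfolding r_def using V by (rule LeastI)
  have rV: "r \<le> V"
    unfolding r_def using V by (rule Least_le)
  have top: "top_sum l (masked n v S) \<le> int l * int r + (\<Sum>e\<in>S. max 0 (int (v e) - int r))"
    using top_sum_le_threshold[of "int r" l "masked n v S"] masked_excess[OF S, of "int r" v]
    by simp
  show ?thesis
  proof (cases r)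
    case 0
    have "(\<Sum>e\<in>S \<inter> tie_above v r 0. v e) = (\<Sum>e\<in>S. v e)"
      using fin 0 by (intro sum.mono_neutral_left) (auto simp: tie_above_def)
    then have "top_sum l (masked n v S) \<le> int (\<Sum>e\<in>S \<inter> tie_above v r 0. v e)"
      using top 0 by simp
    then show ?thesis using r rV unfolding V_def by blast
  next
    case (Suc r')
    have "\<not> card (S \<inter> tie_above v r' 0) \<le> l"
      using Suc not_less_Least[of r' "\<lambda>r. card (S \<inter> tie_above v r 0) \<le> l"] by (simp add: r_def)
    \<comment> \<open>On positions below \<open>n\<close>, admitting all ties at \<open>r\<close>
      amounts to lowering the threshold by one, which admits too many elements by minimality of
      \<open>r\<close>.\<close>
    moreover have "S \<inter> tie_above v r' 0 = S \<inter> tie_above v r n"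
      using S Suc by (auto simp: tie_above_def)
    ultimately have large: "l < card (S \<inter> tie_above v r n)" by simp
    define j where "j = (GREATEST j. j \<le> n \<and> card (S \<inter> tie_above v r j) \<le> l)"
    have j: "j \<le> n \<and> card (S \<inter> tie_above v r j) \<le> l"
      unfolding j_def by (rule GreatestI_nat[where b = n and k = 0]) (use r in auto)
    have maxj: "i \<le> j" if "i \<le> n \<and> card (S \<inter> tie_above v r i) \<le> l" for i
      unfolding j_def using that by (intro Greatest_le_nat[where b = n]) auto
    have "j \<noteq> n" using j large by auto
    with j have "Suc j \<le> n" by simp
    with maxj[of "Suc j"] have "l < card (S \<inter> tie_above v r (Suc j))"
      by (meson Suc_n_not_le_n linorder_not_le)
    \<comment> \<open>Raising the position by one admits at most the element \<open>j\<close>, so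
      the count cannot jump over \<open>l\<close>.\<close>
    also have "\<dots> \<le> card (insert j (S \<inter> tie_above v r j))"
      using fin by (intro card_mono) (auto simp: tie_above_def less_Suc_eq)
    also have "\<dots> \<le> Suc (card (S \<inter> tie_above v r j))"
      using fin by (simp add: card_insert_if)
    finally have card: "card (S \<inter> tie_above v r j) = l" using j by simp
    have "(\<Sum>e\<in>S. max 0 (int (v e) - int r)) = (\<Sum>e\<in>S \<inter> tie_above v r j. max 0 (int (v e) - int r))"
      using fin by (intro sum.mono_neutral_right) (auto simp: tie_above_def)
    also have "\<dots> = (\<Sum>e\<in>S \<inter> tie_above v r j. int (v e) - int r)"
      by (intro sum.cong) (auto simp: tie_above_def of_bool_def split: if_splits)
    also have "\<dots> = int (\<Sum>e\<in>S \<inter> tie_above v r j. v e) - int l * int r"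
      by (simp add: sum_subtractf card)
    finally show ?thesis using top j rV unfolding V_def by auto
  qed
qed

section \<open>Time-bounded execution\<close>

text \<open>Total correctness with a time bound from one start state. The postcondition may itself
  be a \<open>runs\<close> statement about the continuation, which is how \<open>runs_Seq\<close>
  chains programs.\<close>

definition runs :: "com \<Rightarrow> state \<Rightarrow> nat \<Rightarrow> (state \<Rightarrow> bool) \<Rightarrow> bool" where
  "runs c s T Q \<longleftrightarrow> (\<exists>t s'. exec c s t s' \<and> t \<le> T \<and> Q s')"

lemma runs_mono:
  assumes "runs c s T Q" "T \<le> T'" "\<And>s'. Q s' \<Longrightarrow> Q' s'"
  shows "runs c s T' Q'"
  using assms unfolding runs_def by (meson order_trans)

lemma runs_Skip: "Q s \<Longrightarrow> 1 \<le> T \<Longrightarrow> runs Skip s T Q"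
  unfolding runs_def using exec_Skip by blast

lemma runs_Assign: "Q (s(i := eval_expr a s)) \<Longrightarrow> runs (Assign i a) s 1 Q"
  unfolding runs_def using exec_Assign by blast

lemma runs_Seq: "runs c s T (\<lambda>s'. runs d s' U Q) \<Longrightarrow> runs (Seq c d) s (T + U) Q"
  unfolding runs_def by (meson add_mono exec_Seq)

lemma runs_Assign_Seq:
  "runs d (s(i := eval_expr a s)) U Q \<Longrightarrow> runs (Seq (Assign i a) d) s (1 + U) Q"
  by (intro runs_Seq runs_Assign)

lemma runs_Cond:
  assumes "eval_expr a s \<noteq> Num 0 \<Longrightarrow> runs c s T Q" "eval_expr a s = Num 0 \<Longrightarrow> runs d s T Q"
  shows "runs (Cond a c d) s (1 + T) Q"
proof (cases "eval_expr a s = Num 0")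
  case True
  then show ?thesis
    using assms(2) exec_CondF[OF True] unfolding runs_def by (meson add_left_mono)
next
  case False
  then show ?thesis
    using assms(1) exec_CondT[OF False] unfolding runs_def by (meson add_left_mono)
qed

text \<open>The index of \<open>I\<close> is the number of rounds left. Each round pays 1 for its
  test, and the final \<open>+ 1\<close> is the failing test.\<close>

lemma runs_While:
  assumes "I k s"
    and exit: "\<And>s. I 0 s \<Longrightarrow> eval_expr a s = Num 0"
    and step: "\<And>i s. I (Suc i) s \<Longrightarrow> i < k \<Longrightarrow> eval_expr a s \<noteq> Num 0 \<and> runs c s T (I i)"
  shows "runs (While a c) s (k * (1 + T) + 1) (I 0)"
  \<comment> \<open>The hypothesis on the body is limited to \<open>i < k\<close>, so it enters the
    induction along with the start state.\<close>
  using assms(1) step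
proof (induction k arbitrary: s)
  case 0
  then show ?case
    unfolding runs_def using exit exec_WhileF by fastforce
next
  case (Suc k)
  from Suc.prems(2)[OF Suc.prems(1)] obtain t s' where
    *: "eval_expr a s \<noteq> Num 0" "exec c s t s'" "t \<le> T" "I k s'"
    unfolding runs_def by auto
  have "runs (While a c) s' (k * (1 + T) + 1) (I 0)"
    using *(4) by (rule Suc.IH) (use Suc.prems(2) in auto)
  then obtain u s'' where u: "exec (While a c) s' u s''" "u \<le> k * (1 + T) + 1" "I 0 s''"
    unfolding runs_def by blast
  have "exec (While a c) s (1 + t + u) s''"
    using * u by (intro exec_WhileT)
  then show ?case
    unfolding runs_def using * u by (intro exI[of _ "1 + t + u"] exI[of _ s'']) auto
qed

text \<open>The body sees the values \<open>k - 1, \<dots>, 0\<close> of the counter \<open>i\<close>, in this order.\<close>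

definition For :: "nat \<Rightarrow> expr \<Rightarrow> com \<Rightarrow> com" where
  "For i a c = Seq (Assign i a) (While (Var i) (Seq (Assign i (Sub (Var i) (Lit 1))) c))"

text \<open>The body must leave the counter unchanged, so \<open>I\<close> need not track it. A
  round adds a test and a decrement to the body; the outer 2 is the initialization and the failing
  test.\<close>

lemma runs_For:
  assumes "eval_expr a s = Num k" "I k (s(i := Num k))"
    and body: "\<And>m s. I (Suc m) s \<Longrightarrow> m < k \<Longrightarrow>
      runs c (s(i := Num m)) T (\<lambda>s'. s' i = Num m \<and> I m s')"
  shows "runs (For i a c) s (k * (2 + T) + 2) (I 0)"
proof -
  have "runs (While (Var i) (Seq (Assign i (Sub (Var i) (Lit 1))) c)) (s(i := Num k))
      (k * (1 + (1 + T)) + 1) (\<lambda>s'. s' i = Num 0 \<and> I 0 s')"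
  proof (rule runs_While[where I = "\<lambda>m s. s i = Num m \<and> I m s"])
    fix m s assume *: "s i = Num (Suc m) \<and> I (Suc m) s" "m < k"
    have "s(i := eval_expr (Sub (Var i) (Lit 1)) s) = s(i := Num m)"
      using * by simp
    then show "eval_expr (Var i) s \<noteq> Num 0 \<and>
        runs (Seq (Assign i (Sub (Var i) (Lit 1))) c) s (1 + T) (\<lambda>s'. s' i = Num m \<and> I m s')"
      using * body[of m s] by (intro conjI runs_Assign_Seq) auto
  qed (use assms in auto)
  then have "runs (For i a c) s (1 + (k * (1 + (1 + T)) + 1)) (\<lambda>s'. s' i = Num 0 \<and> I 0 s')"
    unfolding For_def using assms(1) by (intro runs_Assign_Seq) simp
  then show ?thesis by (rule runs_mono) auto
qed

section \<open>Running the solver inside a larger state\<close>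

primrec expr_bound :: "expr \<Rightarrow> nat" where
  "expr_bound (Lit k) = 0"
| "expr_bound (Var i) = Suc i"
| "expr_bound (MkPair a b) = max (expr_bound a) (expr_bound b)"
| "expr_bound (Fst a) = expr_bound a"
| "expr_bound (Snd a) = expr_bound a"
| "expr_bound (IsPair a) = expr_bound a"
| "expr_bound (Add a b) = max (expr_bound a) (expr_bound b)"
| "expr_bound (Sub a b) = max (expr_bound a) (expr_bound b)"

primrec com_bound :: "com \<Rightarrow> nat" where
  "com_bound Skip = 0"
| "com_bound (Assign i a) = max (Suc i) (expr_bound a)"
| "com_bound (Seq c d) = max (com_bound c) (com_bound d)"
| "com_bound (Cond a c d) = max (expr_bound a) (max (com_bound c) (com_bound d))"
| "com_bound (While a c) = max (expr_bound a) (com_bound c)"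

lemma eval_expr_cong:
  "expr_bound a \<le> N \<Longrightarrow> (\<And>i. i < N \<Longrightarrow> s i = r i) \<Longrightarrow> eval_expr a s = eval_expr a r"
  by (induction a) auto

text \<open>A program reads and writes only variables below its bound, so a run can be replayed step
  for step from any state that agrees there. This carries the guarantee for
  \<open>init_state\<close> over to the caller's state.\<close>

lemma exec_transfer:
  assumes "exec c s t s'" "com_bound c \<le> N" "\<forall>i<N. s i = r i"
  shows "\<exists>r'. exec c r t r' \<and> (\<forall>i<N. s' i = r' i) \<and> (\<forall>i\<ge>N. r' i = r i)"
  using assms
proof (induction arbitrary: r rule: exec.induct)
  case (exec_Skip s)
  then show ?case using exec.exec_Skip by blast
next
  case (exec_Assign i a s)
  then have "eval_expr a s = eval_expr a r" by (intro eval_expr_cong) auto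
  with exec_Assign.prems have "\<forall>k<N. (s(i := eval_expr a s)) k = (r(i := eval_expr a r)) k"
    "\<forall>k\<ge>N. (r(i := eval_expr a r)) k = r k"
    by auto
  then show ?case
    by (intro exI[where x = "r(i := eval_expr a r)"] conjI) (rule exec.exec_Assign)
next
  case (exec_Seq c s t s' d u s'')
  have "\<exists>r'. exec c r t r' \<and> (\<forall>i<N. s' i = r' i) \<and> (\<forall>i\<ge>N. r' i = r i)"
    by (rule exec_Seq.IH(1)) (use exec_Seq.prems in auto)
  then obtain r' where r': "exec c r t r'" "\<forall>i<N. s' i = r' i" "\<forall>i\<ge>N. r' i = r i"
    by blast
  have "\<exists>r''. exec d r' u r'' \<and> (\<forall>i<N. s'' i = r'' i) \<and> (\<forall>i\<ge>N. r'' i = r' i)"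
    by (rule exec_Seq.IH(2)) (use exec_Seq.prems r' in auto)
  with r' show ?case by (metis exec.exec_Seq)
next
  case (exec_CondT a s c t s' d)
  then have "eval_expr a s = eval_expr a r" by (intro eval_expr_cong) auto
  moreover have "\<exists>r'. exec c r t r' \<and> (\<forall>i<N. s' i = r' i) \<and> (\<forall>i\<ge>N. r' i = r i)"
    by (rule exec_CondT.IH) (use exec_CondT.prems in auto)
  ultimately show ?case using exec_CondT(1) by (metis exec.exec_CondT)
next
  case (exec_CondF a s d t s' c)
  then have "eval_expr a s = eval_expr a r" by (intro eval_expr_cong) auto
  moreover have "\<exists>r'. exec d r t r' \<and> (\<forall>i<N. s' i = r' i) \<and> (\<forall>i\<ge>N. r' i = r i)"
    by (rule exec_CondF.IH) (use exec_CondF.prems in auto)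
  ultimately show ?case using exec_CondF(1) by (metis exec.exec_CondF)
next
  case (exec_WhileF a s c)
  then have "eval_expr a s = eval_expr a r" by (intro eval_expr_cong) auto
  then show ?case using exec_WhileF by (metis exec.exec_WhileF)
next
  case (exec_WhileT a s c t s' u s'')
  then have a: "eval_expr a s = eval_expr a r" by (intro eval_expr_cong) auto
  have "\<exists>r'. exec c r t r' \<and> (\<forall>i<N. s' i = r' i) \<and> (\<forall>i\<ge>N. r' i = r i)"
    by (rule exec_WhileT.IH(1)) (use exec_WhileT.prems in auto)
  then obtain r' where r': "exec c r t r'" "\<forall>i<N. s' i = r' i" "\<forall>i\<ge>N. r' i = r i"
    by blast
  have "\<exists>r''. exec (While a c) r' u r'' \<and> (\<forall>i<N. s'' i = r'' i) \<and> (\<forall>i\<ge>N. r'' i = r' i)"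
    by (rule exec_WhileT.IH(2)) (use exec_WhileT.prems r' in auto)
  with r' a exec_WhileT(1) show ?case by (metis exec.exec_WhileT)
qed

text \<open>The solver is specified only from \<open>init_state\<close>, so what an earlier call
  left in its variables has to be cleared.\<close>

primrec reset :: "nat \<Rightarrow> com" where
  "reset 0 = Skip"
| "reset (Suc k) = Seq (reset k) (Assign k (Lit 0))"

lemma runs_reset: "runs (reset k) s (k + 1) (\<lambda>s'. s' = (\<lambda>i. if i < k then Num 0 else s i))"
proof (induction k)
  case 0
  then show ?case by (auto intro: runs_Skip)
next
  case (Suc k)
  have "runs (reset (Suc k)) s ((k + 1) + 1) (\<lambda>s'. s' = (\<lambda>i. if i < Suc k then Num 0 else s i))"
    unfolding reset.simps
    by (rule runs_Seq, rule runs_mono[OF Suc order_refl], rule runs_Assign) (auto simp: fun_eq_iff)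
  then show ?case by simp
qed

definition call :: "nat \<Rightarrow> com \<Rightarrow> expr \<Rightarrow> com" where
  "call N c a = Seq (reset N) (Seq (Assign 0 a) c)"

text \<open>Variables from \<open>N\<close> on are private to the caller.  The argument is evaluated after the
  reset, so it may only mention these.\<close>

lemma runs_call:
  assumes "com_bound c \<le> N" "0 < N" "outputs_within c x T y"
    and arg: "\<And>s'. (\<And>i. N \<le> i \<Longrightarrow> s' i = s i) \<Longrightarrow> eval_expr a s' = x"
  shows "runs (call N c a) s (N + 2 + T) (\<lambda>s'. s' 0 = y \<and> (\<forall>i\<ge>N. s' i = s i))"
proof -
  obtain t s' where s': "exec c (init_state x) t s'" "t \<le> T" "s' 0 = y"
    using assms(3) unfolding outputs_within_def by blast
  define s0 where "s0 = (\<lambda>i. if i < N then Num 0 else s i)"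
  have a: "eval_expr a s0 = x" by (rule arg) (simp add: s0_def)
  have "\<forall>i<N. init_state x i = (s0(0 := x)) i"
    by (simp add: init_state_def s0_def)
  from exec_transfer[OF s'(1) assms(1) this] obtain r' where
    "exec c (s0(0 := x)) t r'" "\<forall>i<N. s' i = r' i" "\<forall>i\<ge>N. r' i = (s0(0 := x)) i" by blast
  then have "runs c (s0(0 := x)) T (\<lambda>s'. s' 0 = y \<and> (\<forall>i\<ge>N. s' i = s i))"
    unfolding runs_def using s' assms(2) by (intro exI[of _ t] exI[of _ r']) (auto simp: s0_def)
  then have *: "runs (Seq (Assign 0 a) c) s0 (1 + T) (\<lambda>s'. s' 0 = y \<and> (\<forall>i\<ge>N. s' i = s i))"
    using a by (intro runs_Assign_Seq) simp
  have "runs (call N c a) s (N + 1 + (1 + T)) (\<lambda>s'. s' 0 = y \<and> (\<forall>i\<ge>N. s' i = s i))"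
    unfolding call_def
    by (rule runs_Seq, rule runs_mono[OF runs_reset]) (use * in \<open>auto simp: s0_def\<close>)
  then show ?thesis by simp
qed

section \<open>The reduction\<close>

text \<open>A single input is fixed, but the programs defined below depend only on \<open>N\<close>
  and \<open>c\<close>, so one program serves all inputs. The solver is available for all weights
  \<open>w\<close> and targets \<open>K\<close>; \<open>time\<close> may depend on
  \<open>n\<close>.\<close>

locale top_max_reduction =
  fixes N :: nat and c :: com and F :: "nat set set" and n :: nat and x :: val
    and v :: "nat \<Rightarrow> nat" and l :: nat and time :: "nat \<Rightarrow> nat"
  assumes bound: "com_bound c \<le> N" and N_pos: "0 < N"
    and F: "F \<subseteq> Pow {..<n}"
    and solver: "\<exists>r. outputs_within c (enc_input x n w K) (time K) (enc_answer n r) \<and>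
      exact_answer F w K r"
    and time_mono: "mono time"
begin

section \<open>Registers of the caller, out of the solver's reach\<close>

abbreviation "instR \<equiv> N"
abbreviation "valsR \<equiv> N + 1"
abbreviation "rvalsR \<equiv> N + 2"
abbreviation "ellR \<equiv> N + 3"
abbreviation "sizeR \<equiv> N + 4"
abbreviation "modR \<equiv> N + 5"
abbreviation "bestR \<equiv> N + 6"
abbreviation "ansR \<equiv> N + 7"
abbreviation "thrR \<equiv> N + 8"
abbreviation "posR \<equiv> N + 9"
abbreviation "cntR \<equiv> N + 10"
abbreviation "baseR \<equiv> N + 11"
abbreviation "sumR \<equiv> N + 12"
abbreviation "wtsR \<equiv> N + 13"
abbreviation "restR \<equiv> N + 14"
abbreviation "idxR \<equiv> N + 15"

section \<open>Weights that encode a count and a value in one total\<close>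

definition M :: nat where "M = Suc (\<Sum>e<n. v e)"

definition weight :: "nat \<Rightarrow> nat \<Rightarrow> nat \<Rightarrow> nat" where
  "weight r j e = (if e \<in> tie_above v r j then M + v e else 0)"

text \<open>By \<open>sum_weight_eq_iff\<close>, the \<open>m < M\<close> for which the query with
  weights \<open>weight r j\<close> and target \<open>k * M + m\<close> has a solution.\<close>

definition hits :: "nat \<Rightarrow> nat \<Rightarrow> nat \<Rightarrow> nat set" where
  "hits r j k = {m. \<exists>S\<in>F. card (S \<inter> tie_above v r j) = k \<and> (\<Sum>e\<in>S \<inter> tie_above v r j. v e) = m}"

lemma finite_F: "S \<in> F \<Longrightarrow> finite S"
  using F finite_subset by blast

lemma sum_less_M: "S \<in> F \<Longrightarrow> (\<Sum>e\<in>S \<inter> A. v e) < M"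
  using F unfolding M_def less_Suc_eq_le by (intro sum_mono2) auto

lemma hits_less: "m \<in> hits r j k \<Longrightarrow> m < M"
  using sum_less_M by (auto simp: hits_def)

lemma sum_weight:
  assumes "S \<in> F"
  shows "(\<Sum>e\<in>S. weight r j e) =
    card (S \<inter> tie_above v r j) * M + (\<Sum>e\<in>S \<inter> tie_above v r j. v e)"
proof -
  have "(\<Sum>e\<in>S. weight r j e) = (\<Sum>e\<in>S \<inter> tie_above v r j. weight r j e)"
    using finite_F[OF assms] by (intro sum.mono_neutral_right) (auto simp: weight_def)
  also have "\<dots> = (\<Sum>e\<in>S \<inter> tie_above v r j. M + v e)"
    by (intro sum.cong) (auto simp: weight_def)
  finally show ?thesis by (simp add: sum.distrib)
qed

text \<open>Count and value are quotient and remainder of the total modulo \<open>M\<close>, because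
  value sums stay below \<open>M\<close>.\<close>

lemma sum_weight_eq_iff:
  assumes "S \<in> F" "m < M"
  shows "(\<Sum>e\<in>S. weight r j e) = k * M + m \<longleftrightarrow>
    card (S \<inter> tie_above v r j) = k \<and> (\<Sum>e\<in>S \<inter> tie_above v r j. v e) = m"
proof -
  have "a = k \<and> b = m" if "a * M + b = k * M + m" "b < M" for a b
  proof -
    have "(a * M + b) div M = a" "(a * M + b) mod M = b"
      "(k * M + m) div M = k" "(k * M + m) mod M = m"
      using that(2) assms(2) by auto
    then show ?thesis using that(1) by metis
  qed
  then show ?thesis
    using sum_weight[OF assms(1)] sum_less_M[OF assms(1)] by auto
qed

text \<open>The invariant of the search, with \<open>D\<close> the hits covered so far.
  \<open>bestR\<close> holds one more than the best value found, and 0 stands for no answer yet, so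
  that a solution of value 0 is still recorded.\<close>

definition good :: "nat set \<Rightarrow> state \<Rightarrow> bool" where
  "good D s \<longleftrightarrow>
    s instR = x \<and> s rvalsR = enc_list (rev (map v [0..<n])) \<and> s ellR = Num l \<and>
    s sizeR = Num n \<and> s modR = Num M \<and>
    (\<exists>b r. s bestR = Num b \<and> s ansR = enc_answer n r \<and> (\<forall>m\<in>D. m < b) \<and>
      (case r of None \<Rightarrow> b = 0
       | Some S \<Rightarrow> S \<in> F \<and> int b \<le> 1 + top_sum l (masked n v S)))"

text \<open>The list is consumed from its reversal, so that the weights come out in the original order.
  For truncated subtraction, \<open>1 - (1 - (j - i)) = of_bool (i < j)\<close>.\<close>

definition weigh :: com where
  "weigh =
    Seq (Assign wtsR (Lit 0)) (Seq (Assign restR (Var rvalsR)) (Seq (Assign idxR (Var sizeR))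
      (While (IsPair (Var restR))
        (Seq (Assign idxR (Sub (Var idxR) (Lit 1)))
        (Seq (Cond (Sub (Add (Fst (Var restR)) (Sub (Lit 1) (Sub (Lit 1) (Sub (Var posR) (Var idxR)))))
                (Var thrR))
              (Assign wtsR (MkPair (Add (Var modR) (Fst (Var restR))) (Var wtsR)))
              (Assign wtsR (MkPair (Lit 0) (Var wtsR))))
          (Assign restR (Snd (Var restR))))))))"

lemma runs_weigh:
  assumes "good D s" "s thrR = Num r" "s posR = Num j"
  shows "runs weigh s (5 * n + 4) (\<lambda>s'. s' wtsR = enc_list (map (weight r j) [0..<n]) \<and>
    (\<forall>i. i \<notin> {wtsR, restR, idxR} \<longrightarrow> s' i = s i))"
proof -
  \<comment> \<open>Here \<open>i\<close> counts the elements still to be weighed, and elements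
    \<open>i\<close> to \<open>n - 1\<close> already have their weights.\<close>
  let ?I = "\<lambda>i s'. s' idxR = Num i \<and> s' restR = enc_list (rev (map v [0..<i])) \<and>
    s' wtsR = enc_list (map (weight r j) [i..<n]) \<and> i \<le> n \<and>
    (\<forall>i. i \<notin> {wtsR, restR, idxR} \<longrightarrow> s' i = s i)"
  have vars: "s rvalsR = enc_list (rev (map v [0..<n]))" "s sizeR = Num n" "s modR = Num M"
    using assms(1) by (auto simp: good_def)
  have "runs weigh s (1 + (1 + (1 + (n * (1 + (1 + ((1 + 1) + 1))) + 1)))) (?I 0)"
    unfolding weigh_def
  proof (intro runs_Assign_Seq, rule runs_While[where I = ?I])
    fix i s' assume I: "?I (Suc i) s'"
    then have "map (weight r j) [i..<n] = weight r j i # map (weight r j) [Suc i..<n]"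
      by (simp add: upt_conv_Cons)
    moreover have "s' thrR = Num r" "s' posR = Num j" "s' modR = Num M"
      using I assms vars by auto
    moreover have "i \<in> tie_above v r j \<longleftrightarrow> r < v i + (1 - (1 - (j - i)))"
      by (auto simp: tie_above_def)
    ultimately show "eval_expr (IsPair (Var restR)) s' \<noteq> Num 0 \<and>
      runs (Seq (Assign idxR (Sub (Var idxR) (Lit 1)))
        (Seq (Cond (Sub (Add (Fst (Var restR)) (Sub (Lit 1) (Sub (Lit 1) (Sub (Var posR) (Var idxR)))))
                (Var thrR))
              (Assign wtsR (MkPair (Add (Var modR) (Fst (Var restR))) (Var wtsR)))
              (Assign wtsR (MkPair (Lit 0) (Var wtsR))))
          (Assign restR (Snd (Var restR))))) s' (1 + ((1 + 1) + 1)) (?I i)"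
      using I
      by (intro conjI runs_Assign_Seq runs_Seq runs_Cond runs_Assign) (auto simp: weight_def)
  qed (use vars in auto)
  then show ?thesis by (rule runs_mono) auto
qed

text \<open>One query. A refusal is encoded as a number, so \<open>IsPair\<close> detects success;
  the truncated difference is nonzero iff the new value beats the recorded one.\<close>

definition probe :: com where
  "probe =
    Seq weigh
    (Seq (call N c (MkPair (Var instR) (MkPair (Var wtsR) (Add (Var baseR) (Var sumR)))))
      (Cond (IsPair (Var 0))
        (Cond (Sub (Add (Var sumR) (Lit 1)) (Var bestR))
          (Seq (Assign ansR (Var 0)) (Assign bestR (Add (Var sumR) (Lit 1))))
          Skip)
        Skip))"

text \<open>\<open>Suc n * M\<close> dominates every target \<open>k * M + m\<close> with
  \<open>k \<le> n\<close> and \<open>m < M\<close>.\<close>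

definition probe_time :: nat where
  "probe_time = 5 * n + N + 10 + time (Suc n * M)"

text \<open>A refusal shows that \<open>m\<close> is no hit. A solution meets the threshold set in
  \<open>k \<le> l\<close> elements, so \<open>m\<close> is a lower bound for its top sum and may be
  recorded; if it is not recorded, \<open>m\<close> already lies below \<open>bestR\<close>.\<close>

lemma good_update:
  assumes good: "good D s" and k: "k \<le> l" "m < M"
    and exact: "exact_answer F (weight r j) (k * M + m) a"
    and same: "s' instR = s instR" "s' rvalsR = s rvalsR" "s' ellR = s ellR" "s' sizeR = s sizeR"
      "s' modR = s modR"
    and upd: "if a \<noteq> None \<and> num_of (s bestR) < m + 1
      then s' ansR = enc_answer n a \<and> s' bestR = Num (m + 1)
      else s' ansR = s ansR \<and> s' bestR = s bestR"
  shows "good (D \<union> (hits r j k \<inter> {m})) s'"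
proof -
  obtain b r0 where b: "s bestR = Num b" "s ansR = enc_answer n r0" "\<forall>m\<in>D. m < b"
    "case r0 of None \<Rightarrow> b = 0 | Some S \<Rightarrow> S \<in> F \<and> int b \<le> 1 + top_sum l (masked n v S)"
    using good unfolding good_def by blast
  have none: "m \<notin> hits r j k" if "a = None"
    using exact that sum_weight_eq_iff[OF _ k(2)] by (auto simp: exact_answer_def hits_def)
  show ?thesis
  proof (cases "a \<noteq> None \<and> b < m + 1")
    case True
    then obtain S where S: "a = Some S" by blast
    with exact have "S \<in> F" "(\<Sum>e\<in>S. weight r j e) = k * M + m"
      by (auto simp: exact_answer_def)
    then have "card (S \<inter> tie_above v r j) = k" "(\<Sum>e\<in>S \<inter> tie_above v r j. v e) = m"
      using sum_weight_eq_iff[OF _ k(2)] by auto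
    then have "int m \<le> top_sum l (masked n v S)"
      using sum_le_top_sum[of S n "S \<inter> tie_above v r j" l v] \<open>S \<in> F\<close> F k(1) by auto
    then show ?thesis
      using True S \<open>S \<in> F\<close> good same upd b
      unfolding good_def by (auto intro!: exI[of _ a] dest: less_trans)
  next
    case False
    with none have "\<forall>m'\<in>D \<union> (hits r j k \<inter> {m}). m' < b"
      using b(3) by auto
    then show ?thesis
      using False good same upd b unfolding good_def by auto
  qed
qed

lemma runs_probe:
  assumes good: "good D s" and s: "s thrR = Num r" "s posR = Num j" "s baseR = Num (k * M)" "s sumR = Num m"
    and k: "k \<le> l" "k \<le> n" "m < M"
  shows "runs probe s probe_time (\<lambda>s'. good (D \<union> (hits r j k \<inter> {m})) s' \<and>
    (\<forall>i\<in>{thrR, posR, baseR, sumR, cntR}. s' i = s i))"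
proof -
  let ?K = "k * M + m"
  obtain a where a: "outputs_within c (enc_input x n (weight r j) ?K) (time ?K) (enc_answer n a)"
    "exact_answer F (weight r j) ?K a"
    using solver by blast
  let ?Q = "\<lambda>s'. good (D \<union> (hits r j k \<inter> {m})) s' \<and>
    (\<forall>i\<in>{thrR, posR, baseR, sumR, cntR}. s' i = s i)"
  have "runs probe s ((5 * n + 4) + ((N + 2 + time ?K) + (1 + (1 + (1 + 1))))) ?Q"
    unfolding probe_def
  proof (rule runs_Seq, rule runs_mono[OF runs_weigh[OF good s(1,2)] order_refl], rule runs_Seq)
    fix s1 assume s1: "s1 wtsR = enc_list (map (weight r j) [0..<n]) \<and>
      (\<forall>i. i \<notin> {wtsR, restR, idxR} \<longrightarrow> s1 i = s i)"
    show "runs (call N c (MkPair (Var instR) (MkPair (Var wtsR) (Add (Var baseR) (Var sumR))))) s1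
      (N + 2 + time ?K) (\<lambda>s'. runs (Cond (IsPair (Var 0))
        (Cond (Sub (Add (Var sumR) (Lit 1)) (Var bestR))
          (Seq (Assign ansR (Var 0)) (Assign bestR (Add (Var sumR) (Lit 1)))) Skip) Skip) s'
        (1 + (1 + (1 + 1))) ?Q)"
    proof (rule runs_mono[OF runs_call[OF bound N_pos a(1)] order_refl])
      show "eval_expr (MkPair (Var instR) (MkPair (Var wtsR) (Add (Var baseR) (Var sumR)))) s' =
          enc_input x n (weight r j) ?K" if "\<And>i. N \<le> i \<Longrightarrow> s' i = s1 i" for s'
        using that s1 s good by (simp add: enc_input_def good_def)
    next
      fix s2 assume s2: "s2 0 = enc_answer n a \<and> (\<forall>i\<ge>N. s2 i = s1 i)"
      \<comment> \<open>The registers beyond \<open>sumR\<close> are scratch space of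
        \<open>weigh\<close>.\<close>
      then have eq: "s2 i = s i" if "N \<le> i" "i \<le> sumR" for i
        using s1 that by auto
      have update: "good (D \<union> (hits r j k \<inter> {m})) s'"
        if "\<And>i. N \<le> i \<Longrightarrow> i \<le> modR \<Longrightarrow> s' i = s i"
          "if a \<noteq> None \<and> num_of (s bestR) < m + 1
            then s' ansR = enc_answer n a \<and> s' bestR = Num (m + 1)
            else s' ansR = s ansR \<and> s' bestR = s bestR" for s'
        using good k(1,3) a(2) _ _ _ _ _ that(2) by (rule good_update) (simp_all add: that(1))
      have pair: "is_pair (enc_answer n a) \<longleftrightarrow> a \<noteq> None"
        by (cases a) auto
      show "runs (Cond (IsPair (Var 0))
        (Cond (Sub (Add (Var sumR) (Lit 1)) (Var bestR))
          (Seq (Assign ansR (Var 0)) (Assign bestR (Add (Var sumR) (Lit 1)))) Skip) Skip) s2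
        (1 + (1 + (1 + 1))) ?Q"
        by (intro runs_Cond runs_Seq runs_Assign runs_Skip conjI update)
          (use N_pos pair s s2 in \<open>auto simp: eq split: if_splits\<close>)
    qed
  qed
  moreover have "?K \<le> Suc n * M"
    using k by (simp add: add.commute add_mono)
  then have "time ?K \<le> time (Suc n * M)"
    using time_mono by (rule monoD[rotated])
  ultimately show ?thesis
    unfolding probe_time_def by (elim runs_mono) auto
qed

section \<open>The four nested loops over values, counts, positions and thresholds\<close>

definition sweep_sums :: com where
  "sweep_sums = For sumR (Var modR) probe"

definition sweep_sums_time :: nat where
  "sweep_sums_time = M * (2 + probe_time) + 2"

lemma good_upd [simp]:
  "i \<in> {thrR, posR, baseR, sumR, cntR} \<Longrightarrow> good D (s(i := y)) = good D s"
  by (auto simp: good_def)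

text \<open>\<open>For\<close> counts down, so the indices already handled form an upper interval
  that each round extends at its lower end.\<close>

lemma good_Un_atLeast:
  assumes "good (D \<union> \<Union> (A ` {Suc m..<k}) \<union> A m) s" "m < k"
  shows "good (D \<union> \<Union> (A ` {m..<k})) s"
proof -
  have "{m..<k} = insert m {Suc m..<k}" using assms(2) by auto
  then show ?thesis using assms(1) by (simp add: Un_ac)
qed

lemma runs_sweep_sums:
  assumes "good D s" "s thrR = Num r" "s posR = Num j" "s baseR = Num (k * M)" "k \<le> l" "k \<le> n"
  shows "runs sweep_sums s sweep_sums_time (\<lambda>s'. good (D \<union> hits r j k) s' \<and>
    (\<forall>i\<in>{thrR, posR, baseR, cntR}. s' i = s i))"
proof -
  let ?A = "\<lambda>m. hits r j k \<inter> {m}"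
  let ?I = "\<lambda>m s'. good (D \<union> \<Union> (?A ` {m..<M})) s' \<and>
    (\<forall>i\<in>{thrR, posR, baseR, cntR}. s' i = s i)"
  have "runs sweep_sums s (M * (2 + probe_time) + 2) (?I 0)"
    unfolding sweep_sums_def
  proof (rule runs_For[where I = ?I])
    fix m s' assume *: "?I (Suc m) s'" "m < M"
    show "runs probe (s'(sumR := Num m)) probe_time (\<lambda>s'. s' sumR = Num m \<and> ?I m s')"
    proof (rule runs_mono[OF runs_probe[where D = "D \<union> \<Union> (?A ` {Suc m..<M})" and r = r and j = j
            and k = k and m = m]])
      fix t assume t: "good (D \<union> \<Union> (?A ` {Suc m..<M}) \<union> ?A m) t \<and>
        (\<forall>i\<in>{thrR, posR, baseR, sumR, cntR}. t i = (s'(sumR := Num m)) i)"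
      then show "t sumR = Num m \<and> ?I m t"
        using good_Un_atLeast[of D ?A m M t] * by auto
    qed (use * assms in auto)
  qed (use assms in \<open>auto simp: good_def\<close>)
  \<comment> \<open>All hits lie below \<open>M\<close>, so the loop misses none.\<close>
  moreover have "\<Union> (?A ` {0..<M}) = hits r j k"
    using hits_less by auto
  ultimately show ?thesis
    unfolding sweep_sums_time_def by (elim runs_mono) auto
qed

text \<open>Without multiplication, the summand \<open>k * M\<close> of the target is accumulated in \<open>baseR\<close>.  By truncated
  subtraction the number of rounds is \<open>n + 1 - (n - l) = min n l + 1\<close>, bounded even for huge \<open>l\<close>.\<close>

definition sweep_counts :: com where
  "sweep_counts = Seq (Assign baseR (Lit 0))
    (For cntR (Sub (Add (Var sizeR) (Lit 1)) (Sub (Var sizeR) (Var ellR)))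
      (Seq sweep_sums (Assign baseR (Add (Var baseR) (Var modR)))))"

definition sweep_counts_time :: nat where
  "sweep_counts_time = 1 + (Suc n * (2 + (sweep_sums_time + 1)) + 2)"

lemma runs_sweep_counts:
  assumes "good D s" "s thrR = Num r" "s posR = Num j"
  shows "runs sweep_counts s sweep_counts_time (\<lambda>s'. good (D \<union> (\<Union>k\<le>min n l. hits r j k)) s' \<and>
    (\<forall>i\<in>{thrR, posR}. s' i = s i))"
proof -
  let ?K = "Suc (min n l)"
  let ?I = "\<lambda>m s'. good (D \<union> (\<Union>k<?K - m. hits r j k)) s' \<and> s' baseR = Num ((?K - m) * M) \<and>
    (\<forall>i\<in>{thrR, posR}. s' i = s i)"
  have s: "s sizeR = Num n" "s ellR = Num l"
    using assms(1) by (auto simp: good_def)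
  have "runs sweep_counts s (1 + (?K * (2 + (sweep_sums_time + 1)) + 2)) (?I 0)"
    unfolding sweep_counts_def
  proof (intro runs_Assign_Seq, rule runs_For[where I = ?I])
    fix m s' assume *: "?I (Suc m) s'" "m < ?K"
    \<comment> \<open>The counter descends while \<open>k\<close> ascends, in step with the multiple
      of \<open>M\<close> accumulated in \<open>baseR\<close>.\<close>
    define k where "k = ?K - Suc m"
    have k: "k \<le> l" "k \<le> n" "?K - m = Suc k" "?K - Suc m = k"
      using *(2) by (auto simp: k_def)
    show "runs (Seq sweep_sums (Assign baseR (Add (Var baseR) (Var modR)))) (s'(cntR := Num m))
      (sweep_sums_time + 1) (\<lambda>s'. s' cntR = Num m \<and> ?I m s')"
    proof (rule runs_Seq, rule runs_mono[OF runs_sweep_sums[where D = "D \<union> (\<Union>i<k. hits r j i)"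
            and r = r and j = j and k = k]])
      fix t assume t: "good (D \<union> (\<Union>i<k. hits r j i) \<union> hits r j k) t \<and>
        (\<forall>i\<in>{thrR, posR, baseR, cntR}. t i = (s'(cntR := Num m)) i)"
      moreover from t have "t modR = Num M" by (simp add: good_def)
      moreover have "D \<union> (\<Union>i<k. hits r j i) \<union> hits r j k = D \<union> (\<Union>i<Suc k. hits r j i)"
        by (auto simp: lessThan_Suc)
      ultimately show "runs (Assign baseR (Add (Var baseR) (Var modR))) t 1
        (\<lambda>s'. s' cntR = Num m \<and> ?I m s')"
        using *(1) unfolding k by (intro runs_Assign) auto
    qed (use * assms k in auto)
  qed (use assms s in auto)
  \<comment> \<open>This makes the loop's time bound independent of \<open>l\<close>.\<close>
  moreover have "?K * (2 + (sweep_sums_time + 1)) \<le> Suc n * (2 + (sweep_sums_time + 1))"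
    by (intro mult_right_mono) auto
  ultimately show ?thesis
    unfolding sweep_counts_time_def by (elim runs_mono) (auto simp: lessThan_Suc_atMost)
qed

definition sweep_positions :: com where
  "sweep_positions = For posR (Add (Var sizeR) (Lit 1)) sweep_counts"

definition sweep_positions_time :: nat where
  "sweep_positions_time = Suc n * (2 + sweep_counts_time) + 2"

lemma runs_sweep_positions:
  assumes "good D s" "s thrR = Num r"
  shows "runs sweep_positions s sweep_positions_time
    (\<lambda>s'. good (D \<union> (\<Union>j\<in>{0..<Suc n}. \<Union>k\<le>min n l. hits r j k)) s' \<and> s' thrR = s thrR)"
proof -
  let ?A = "\<lambda>j. \<Union>k\<le>min n l. hits r j k"
  let ?I = "\<lambda>m s'. good (D \<union> \<Union> (?A ` {m..<Suc n})) s' \<and> s' thrR = s thrR"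
  have "s sizeR = Num n"
    using assms(1) by (auto simp: good_def)
  show ?thesis
    unfolding sweep_positions_def sweep_positions_time_def
  proof (rule runs_For[where I = ?I])
    fix m s' assume *: "?I (Suc m) s'" "m < Suc n"
    show "runs sweep_counts (s'(posR := Num m)) sweep_counts_time (\<lambda>s'. s' posR = Num m \<and> ?I m s')"
    proof (rule runs_mono[OF runs_sweep_counts[where D = "D \<union> \<Union> (?A ` {Suc m..<Suc n})" and r = r
            and j = m]])
      fix t assume "good (D \<union> \<Union> (?A ` {Suc m..<Suc n}) \<union> ?A m) t \<and>
        (\<forall>i\<in>{thrR, posR}. t i = (s'(posR := Num m)) i)"
      then show "t posR = Num m \<and> ?I m t"
        using good_Un_atLeast[of D ?A m "Suc n" t] * by auto
    qed (use * assms in auto)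
  qed (use assms \<open>s sizeR = Num n\<close> in auto)
qed

text \<open>Thresholds below \<open>M\<close> are those up to the sum of all values, the range
  supplied by \<open>top_sum_le_above\<close>.\<close>

definition sweep_thresholds :: com where
  "sweep_thresholds = For thrR (Var modR) sweep_positions"

definition sweep_thresholds_time :: nat where
  "sweep_thresholds_time = M * (2 + sweep_positions_time) + 2"

lemma runs_sweep_thresholds:
  assumes "good {} s"
  shows "runs sweep_thresholds s sweep_thresholds_time
    (good (\<Union>r\<in>{0..<M}. \<Union>j\<in>{0..<Suc n}. \<Union>k\<le>min n l. hits r j k))"
proof -
  let ?A = "\<lambda>r. \<Union>j\<in>{0..<Suc n}. \<Union>k\<le>min n l. hits r j k"
  let ?I = "\<lambda>m s'. good (\<Union> (?A ` {m..<M})) s'"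
  have "s modR = Num M"
    using assms by (auto simp: good_def)
  show ?thesis
    unfolding sweep_thresholds_def sweep_thresholds_time_def
  proof (rule runs_For[where I = ?I])
    fix m s' assume *: "?I (Suc m) s'" "m < M"
    show "runs sweep_positions (s'(thrR := Num m)) sweep_positions_time (\<lambda>s'. s' thrR = Num m \<and> ?I m s')"
    proof (rule runs_mono[OF runs_sweep_positions[where D = "\<Union> (?A ` {Suc m..<M})" and r = m]])
      fix t assume "good (\<Union> (?A ` {Suc m..<M}) \<union> ?A m) t \<and>
        t thrR = (s'(thrR := Num m)) thrR"
      then show "t thrR = Num m \<and> ?I m t"
        using good_Un_atLeast[of "{}" ?A m M t] * by auto
    qed (use * in auto)
  qed (use assms \<open>s modR = Num M\<close> in auto)
qed

section \<open>Reading the input and correctness of the whole program\<close>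

definition prelude :: com where
  "prelude =
    Seq (Assign instR (Fst (Var 0))) (Seq (Assign valsR (Fst (Snd (Var 0))))
    (Seq (Assign ellR (Snd (Snd (Var 0)))) (Seq (Assign modR (Lit 1))
      (While (IsPair (Var valsR))
        (Seq (Assign rvalsR (MkPair (Fst (Var valsR)) (Var rvalsR)))
        (Seq (Assign modR (Add (Var modR) (Fst (Var valsR))))
        (Seq (Assign sizeR (Add (Var sizeR) (Lit 1)))
          (Assign valsR (Snd (Var valsR))))))))))"

text \<open>One pass over the values reverses them and computes \<open>n\<close> and
  \<open>M\<close>. The initial \<open>Num 0\<close> serves as the empty list in
  \<open>rvalsR\<close>, as zero in \<open>sizeR\<close> and \<open>bestR\<close>, and as the answer
  \<open>None\<close> in \<open>ansR\<close>.\<close>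

lemma runs_prelude: "runs prelude (init_state (enc_input x n v l)) (5 * n + 5) (good {})"
proof -
  let ?I = "\<lambda>i s. i \<le> n \<and> s instR = x \<and> s ellR = Num l \<and> s bestR = Num 0 \<and> s ansR = Num 0 \<and>
    s valsR = enc_list (map v [n - i..<n]) \<and> s rvalsR = enc_list (rev (map v [0..<n - i])) \<and>
    s modR = Num (Suc (\<Sum>e<n - i. v e)) \<and> s sizeR = Num (n - i)"
  have "runs prelude (init_state (enc_input x n v l))
      (1 + (1 + (1 + (1 + (n * (1 + (1 + (1 + (1 + 1)))) + 1))))) (?I 0)"
    unfolding prelude_def
  proof (intro runs_Assign_Seq, rule runs_While[where I = ?I])
    fix i s assume I: "?I (Suc i) s"
    define k where "k = n - Suc i"
    from I have k: "n - i = Suc k" "n - Suc i = k" "k < n"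
      by (auto simp: k_def)
    then have "map v [k..<n] = v k # map v [Suc k..<n]"
      by (simp add: upt_conv_Cons)
    then show "eval_expr (IsPair (Var valsR)) s \<noteq> Num 0 \<and>
      runs (Seq (Assign rvalsR (MkPair (Fst (Var valsR)) (Var rvalsR)))
        (Seq (Assign modR (Add (Var modR) (Fst (Var valsR))))
        (Seq (Assign sizeR (Add (Var sizeR) (Lit 1)))
          (Assign valsR (Snd (Var valsR)))))) s (1 + (1 + (1 + 1))) (?I i)"
      using I unfolding k
      by (intro conjI runs_Assign_Seq runs_Assign) (auto simp: lessThan_Suc)
  qed (use N_pos in \<open>auto simp: init_state_def enc_input_def\<close>)
  then show ?thesis
    by (rule runs_mono) (auto simp: good_def M_def intro!: exI[of _ None])
qed

definition top_max_prog :: com where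
  "top_max_prog = Seq prelude (Seq sweep_thresholds (Assign 0 (Var ansR)))"

text \<open>By \<open>top_sum_le_above\<close> every feasible top sum is at most some covered hit,
  hence below \<open>b\<close>, whereas the stored set has top sum at least
  \<open>b - 1\<close>.\<close>

lemma top_max_answerI:
  assumes good: "good (\<Union>r\<in>{0..<M}. \<Union>j\<in>{0..<Suc n}. \<Union>k\<le>min n l. hits r j k) s"
  shows "\<exists>a. s ansR = enc_answer n a \<and> top_max_answer n F v l a"
proof -
  let ?D = "\<Union>r\<in>{0..<M}. \<Union>j\<in>{0..<Suc n}. \<Union>k\<le>min n l. hits r j k"
  obtain b a where a: "s ansR = enc_answer n a" and b: "\<forall>m\<in>?D. m < b"
    and ab: "case a of None \<Rightarrow> b = 0
      | Some S \<Rightarrow> S \<in> F \<and> int b \<le> 1 + top_sum l (masked n v S)"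
    using good unfolding good_def by blast
  have less: "top_sum l (masked n v S) < int b" if "S \<in> F" for S
  proof -
    have S: "S \<subseteq> {..<n}" using F that by blast
    obtain r j where rj: "r \<le> (\<Sum>e<n. v e)" "j \<le> n" "card (S \<inter> tie_above v r j) \<le> l"
      and top: "top_sum l (masked n v S) \<le> int (\<Sum>e\<in>S \<inter> tie_above v r j. v e)"
      using top_sum_le_above[OF S] by blast
    have "card (S \<inter> tie_above v r j) \<le> card {..<n}"
      using S by (intro card_mono) auto
    then have "card (S \<inter> tie_above v r j) \<le> min n l"
      using rj(3) by simp
    moreover have "(\<Sum>e\<in>S \<inter> tie_above v r j. v e) \<in> hits r j (card (S \<inter> tie_above v r j))"
      using that by (auto simp: hits_def)
    ultimately have "(\<Sum>e\<in>S \<inter> tie_above v r j. v e) \<in> ?D"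
      using rj(1,2) unfolding UN_iff M_def by (meson atLeastLessThan_iff atMost_iff le_imp_less_Suc zero_le)
    then have "(\<Sum>e\<in>S \<inter> tie_above v r j. v e) < b"
      by (rule b[rule_format])
    with top show ?thesis by linarith
  qed
  have "top_max_answer n F v l a"
  proof (cases a)
    case None
    have "F = {}"
    proof (rule equals0I)
      fix S assume "S \<in> F"
      \<comment> \<open>The empty subset shows that top sums are nonnegative, which contradicts
        \<open>b = 0\<close>.\<close>
      with F have "int (\<Sum>e\<in>{}. v e) \<le> top_sum l (masked n v S)"
        by (intro sum_le_top_sum) auto
      with less[OF \<open>S \<in> F\<close>] None ab show False by simp
    qed
    with None show ?thesis by (simp add: top_max_answer_def)
  next
    case (Some S)
    have "\<not> top_sum l (masked n v S) < top_sum l (masked n v S')" if "S' \<in> F" for S'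
      using less[OF that] ab Some by simp
    with ab Some show ?thesis
      by (simp add: top_max_answer_def is_arg_max_def)
  qed
  with a show ?thesis by blast
qed

lemma top_max_prog_correct:
  "\<exists>a. outputs_within top_max_prog (enc_input x n v l) (5 * n + 6 + sweep_thresholds_time)
      (enc_answer n a) \<and> top_max_answer n F v l a"
proof -
  have "runs top_max_prog (init_state (enc_input x n v l)) ((5 * n + 5) + (sweep_thresholds_time + 1))
      (\<lambda>s. \<exists>a. s 0 = enc_answer n a \<and> top_max_answer n F v l a)"
    unfolding top_max_prog_def
    by (rule runs_Seq, rule runs_mono[OF runs_prelude order_refl], rule runs_Seq,
        rule runs_mono[OF runs_sweep_thresholds order_refl], assumption, rule runs_Assign)
      (use top_max_answerI in auto)
  moreover have "(5 * n + 5) + (sweep_thresholds_time + 1) = 5 * n + 6 + sweep_thresholds_time"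
    by simp
  ultimately show ?thesis
    unfolding runs_def outputs_within_def by metis
qed

end

section \<open>Polynomial bounds\<close>

text \<open>Closure under the operations in the time bound yields the required polynomial without
  writing it out.\<close>

definition poly_fun :: "(nat \<Rightarrow> nat) \<Rightarrow> bool" where
  "poly_fun f \<longleftrightarrow> (\<exists>p. \<forall>n. f n = poly p n)"

lemma poly_fun_poly: "poly_fun f \<Longrightarrow> poly_fun (\<lambda>n. poly p (f n))"
  unfolding poly_fun_def by (metis poly_pcompose)

lemma poly_fun_const: "poly_fun (\<lambda>n. k)"
  unfolding poly_fun_def by (intro exI[of _ "[:k:]"]) simp

lemma poly_fun_id: "poly_fun (\<lambda>n. n)"
  unfolding poly_fun_def by (intro exI[of _ "[:0, 1:]"]) simp

lemma poly_fun_add: "poly_fun f \<Longrightarrow> poly_fun g \<Longrightarrow> poly_fun (\<lambda>n. f n + g n)"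
  unfolding poly_fun_def by (metis poly_add)

lemma poly_fun_mult: "poly_fun f \<Longrightarrow> poly_fun g \<Longrightarrow> poly_fun (\<lambda>n. f n * g n)"
  unfolding poly_fun_def by (metis poly_mult)

lemma poly_fun_Suc: "poly_fun f \<Longrightarrow> poly_fun (\<lambda>n. Suc (f n))"
  using poly_fun_add[OF _ poly_fun_const[of 1]] by simp

lemmas poly_fun_intros =
  poly_fun_poly poly_fun_const poly_fun_id poly_fun_Suc poly_fun_add poly_fun_mult

text \<open>Natural coefficients are nonnegative.\<close>

lemma mono_poly_nat: "mono (poly p)" for p :: "nat poly"
proof (rule monoI)
  fix a b :: nat assume "a \<le> b"
  then show "poly p a \<le> poly p b"
    by (induction p) (auto intro!: mult_mono)
qed

text \<open>The running time of \<open>top_max_prog\<close> with all loop bounds unfolded and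
  \<open>m\<close> in place of \<open>M\<close>, so that \<open>M\<close> can be replaced by a bound
  depending on \<open>n\<close> alone.\<close>

definition reduction_time :: "nat \<Rightarrow> nat poly \<Rightarrow> nat \<Rightarrow> nat \<Rightarrow> nat" where
  "reduction_time N p n m =
    5 * n + 6 + (m * (2 + (Suc n * (2 + (1 + (Suc n * (2 + (
      (m * (2 + (5 * n + N + 10 + poly p (n + Suc n * m))) + 2) + 1)) + 2))) + 2)) + 2)"

lemma reduction_time_mono: "m \<le> m' \<Longrightarrow> reduction_time N p n m \<le> reduction_time N p n m'"
  unfolding reduction_time_def
  by (intro add_mono mult_mono order_refl monoD[OF mono_poly_nat]) auto

theorem theoremB3:
  fixes P :: comb_problem
  assumes "comb_problem P"
    and "exact_pseudopoly_solvable P"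
  shows "\<forall>q :: nat poly. top_max_poly_solvable P q"
proof
  fix q :: "nat poly"
  obtain c p where c: "\<And>x v K. x \<in> instances P \<Longrightarrow> \<exists>r.
      outputs_within c (enc_input x (ground_size P x) v K)
        (poly p (ground_size P x + K)) (enc_answer (ground_size P x) r) \<and>
      exact_answer (feasible P x) v K r"
    using assms(2) unfolding exact_pseudopoly_solvable_def by blast
  \<comment> \<open>The successor guarantees \<open>0 < N\<close>, so variable 0 belongs to the
    solver.\<close>
  define N where "N = Suc (com_bound c)"
  \<comment> \<open>\<open>Suc (n * poly q n)\<close> bounds \<open>M\<close> when each of the
    \<open>n\<close> values is at most \<open>poly q n\<close>.\<close>
  have "poly_fun (\<lambda>n. reduction_time N p n (Suc (n * poly q n)))"
    unfolding reduction_time_def by (intro poly_fun_intros)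
  then obtain p' where p': "\<And>n. reduction_time N p n (Suc (n * poly q n)) = poly p' n"
    unfolding poly_fun_def by blast
  have "\<exists>a. outputs_within (top_max_reduction.top_max_prog N c) (enc_input x (ground_size P x) v l)
        (poly p' (ground_size P x)) (enc_answer (ground_size P x) a) \<and>
      top_max_answer (ground_size P x) (feasible P x) v l a"
    if x: "x \<in> instances P" and v: "\<forall>e<ground_size P x. v e \<le> poly q (ground_size P x)" for x v l
  proof -
    define n where "n = ground_size P x"
    interpret top_max_reduction N c "feasible P x" n x v l "\<lambda>K. poly p (n + K)"
    proof
      show "feasible P x \<subseteq> Pow {..<n}"
        using assms(1) x by (simp add: comb_problem_def n_def)
      show "mono (\<lambda>K. poly p (n + K))"
        by (intro monoI monoD[OF mono_poly_nat]) simp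
    qed (use c[OF x] in \<open>auto simp: N_def n_def\<close>)
    have "(\<Sum>e<n. v e) \<le> (\<Sum>e<n. poly q n)"
      using v by (intro sum_mono) (simp add: n_def)
    then have "M \<le> Suc (n * poly q n)"
      by (simp add: M_def)
    then have "reduction_time N p n M \<le> poly p' n"
      using reduction_time_mono p' by metis
    moreover have "5 * n + 6 + sweep_thresholds_time = reduction_time N p n M"
      by (simp only: reduction_time_def sweep_thresholds_time_def sweep_positions_time_def sweep_counts_time_def
          sweep_sums_time_def probe_time_def)
    ultimately show ?thesis
      using top_max_prog_correct unfolding n_def[symmetric] outputs_within_def
      by (metis order_trans)
  qed
  then show "top_max_poly_solvable P q"
    unfolding top_max_poly_solvable_def by blast
qed

end
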